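(* Let $(\Sigma,\mu)$ be a $\sigma$-finite measure space and let $T:\Sigma\times\Sigma\to\mathbb{R}$ and $f:\Sigma\times\mathbb{R}\to\mathbb{R}$ be real functions satisfying the following conditions: (i) there are numbers $p,q>1$ with $\frac1p+\frac1q=1$ such that $$\lambda=\int_\Sigma\left(\int_\Sigma |T(t,s)|^q\,d\mu(s)\right)^{\frac pq}d\mu(t)<\infty;$$ (ii) $T(t,s)>0$ for almost every $t,s\in\Sigma$; (iii) $f(s,\cdot)$ is increasing for every fixed $s\in\Sigma$, and $f(s,0)>0$ for almost every $s\in\Sigma$; (iv) there is $\gamma>0$ such that $\int_\Sigma |f(s,x(s))|^p\,d\mu(s)\le\frac{\gamma^p}{\lambda}$ for all $x\in L_p(\Sigma,\mu)$ with $\|x\|_p\le\gamma$. Then the nonlinear Hammerstein integral equation $$x(t)=\int_\Sigma T(t,s)f(s,x(s))\,d\mu(s)$$ has a solution $x^*$ in $L_p(\Sigma,\mu)$ with $0<\|x^*\|_p\le\gamma$. Moreover, the solution set of this equation in $L_p(\Sigma,\mu)$ is a nonempty inductive subset of $\{x\in L_p(\Sigma,\mu):\|x\|_p\le\gamma\}$.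
   Context: $L_p(\Sigma,\mu)$ is the real Lebesgue space with norm $\|\cdot\|_p$, ordered by $y\succcurlyeq x$ if and only if $y(t)\ge x(t)$ for almost every $t\in\Sigma$. A solution is an element $x\in L_p(\Sigma,\mu)$ satisfying the equation for almost every $t\in\Sigma$. "Increasing" means $a\le b$ implies $f(s,a)\le f(s,b)$. A subset $A\subseteq L_p(\Sigma,\mu)$ is inductive if every nonempty chain (totally ordered subset) in $A$ has a $\succcurlyeq$-upper bound belonging to $A$. The measure space is nontrivial ($\mu(\Sigma)>0$), and $T$ and the functions $s\mapsto f(s,x(s))$ for $\|x\|_p\le\gamma$ are measurable, as is implicit in writing the integrals in (i) and (iv) and the quotient $\gamma^p/\lambda$.
   Formalization: The solution set in the last sentence is taken to be the set of solutions with norm at most γ; literally, solutions of norm above γ can exist (one point of mass 1, T=1, p=q=2, γ=1, f=1/2 for x≤1 and f=2 for x>1 has the solution x=2). *)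

theory Defs
  imports "HOL-Analysis.Analysis"
begin

text \<open>
  Elements of \<open>L\<^sub>p\<close> are almost-everywhere classes of \<open>p\<close>-integrable measurable functions, so that the
  norm is a norm and the order is antisymmetric. \<open>Lp_fun\<close> and \<open>Lp_seminorm\<close> live on representatives.
\<close>

definition Lp_fun :: "real \<Rightarrow> 'a measure \<Rightarrow> ('a \<Rightarrow> real) set" where
  "Lp_fun p M = {x \<in> borel_measurable M. (\<integral>\<^sup>+ s. ennreal (\<bar>x s\<bar> powr p) \<partial>M) < \<infinity>}"

definition Lp_seminorm :: "real \<Rightarrow> 'a measure \<Rightarrow> ('a \<Rightarrow> real) \<Rightarrow> real" where
  "Lp_seminorm p M x = (LINT s|M. \<bar>x s\<bar> powr p) powr (1 / p)"

definition Lp_eq :: "real \<Rightarrow> 'a measure \<Rightarrow> (('a \<Rightarrow> real) \<times> ('a \<Rightarrow> real)) set" where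
  "Lp_eq p M = {(x, y). x \<in> Lp_fun p M \<and> y \<in> Lp_fun p M \<and> (AE t in M. x t = y t)}"

definition Lp_space :: "real \<Rightarrow> 'a measure \<Rightarrow> ('a \<Rightarrow> real) set set" where
  "Lp_space p M = Lp_fun p M // Lp_eq p M"

definition Lp_norm :: "real \<Rightarrow> 'a measure \<Rightarrow> ('a \<Rightarrow> real) set \<Rightarrow> real" where
  "Lp_norm p M X = the_elem (Lp_seminorm p M ` X)"

definition Lp_le :: "real \<Rightarrow> 'a measure \<Rightarrow> (('a \<Rightarrow> real) set \<times> ('a \<Rightarrow> real) set) set" where
  "Lp_le p M = {(X, Y). X \<in> Lp_space p M \<and> Y \<in> Lp_space p M \<and>
     (\<forall>x\<in>X. \<forall>y\<in>Y. AE t in M. x t \<le> y t)}"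

lemma equiv_Lp_eq: "equiv (Lp_fun p M) (Lp_eq p M)"
proof (rule equivI)
  show "Lp_eq p M \<subseteq> Lp_fun p M \<times> Lp_fun p M" "refl_on (Lp_fun p M) (Lp_eq p M)" "sym (Lp_eq p M)"
    by (auto simp: Lp_eq_def refl_on_def sym_def)
  show "trans (Lp_eq p M)"
    unfolding trans_def Lp_eq_def by (auto elim: AE_mp)
qed

lemma Lp_norm_eq:
  assumes "X \<in> Lp_space p M" and "x \<in> X"
  shows "Lp_norm p M X = Lp_seminorm p M x"
proof -
  have "Lp_seminorm p M y = Lp_seminorm p M x" if "y \<in> X" for y
  proof -
    have "(y, x) \<in> Lp_eq p M"
      using quotient_eq_iff[OF equiv_Lp_eq, of X p M X y x] assms that by (simp add: Lp_space_def)
    then have "(LINT s|M. \<bar>y s\<bar> powr p) = (LINT s|M. \<bar>x s\<bar> powr p)"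
      by (intro integral_cong_AE) (auto simp: Lp_eq_def Lp_fun_def)
    then show ?thesis
      by (simp add: Lp_seminorm_def)
  qed
  then have "Lp_seminorm p M ` X = {Lp_seminorm p M x}"
    using assms(2) by blast
  then show ?thesis
    by (simp add: Lp_norm_def)
qed

definition inductive_subset :: "('b \<times> 'b) set \<Rightarrow> 'b set \<Rightarrow> bool" where
  "inductive_subset r A \<longleftrightarrow>
     (\<forall>C \<in> Chains r. C \<subseteq> A \<and> C \<noteq> {} \<longrightarrow> (\<exists>u\<in>A. \<forall>c\<in>C. (c, u) \<in> r))"

text \<open>
  Real powers of extended nonnegative numbers, for positive exponents: \<open>\<infinity>\<close> is kept as \<open>\<infinity>\<close>
  (\<open>enn2real\<close> alone would send it to \<open>0\<close>).
\<close>

definition ennpowr :: "ennreal \<Rightarrow> real \<Rightarrow> ennreal" where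
  "ennpowr a r = (if a = \<infinity> then \<infinity> else ennreal (enn2real a powr r))"

definition kernel_const :: "real \<Rightarrow> real \<Rightarrow> 'a measure \<Rightarrow> ('a \<Rightarrow> 'a \<Rightarrow> real) \<Rightarrow> ennreal" where
  "kernel_const p q M T =
     (\<integral>\<^sup>+ t. ennpowr (\<integral>\<^sup>+ s. ennreal (\<bar>T t s\<bar> powr q) \<partial>M) (p / q) \<partial>M)"

text \<open>
  Integrability is part of being a solution, since the Bochner integral of a non-integrable
  function is \<open>0\<close> by convention.
\<close>

definition hammerstein_solutions ::
  "real \<Rightarrow> 'a measure \<Rightarrow> ('a \<Rightarrow> 'a \<Rightarrow> real) \<Rightarrow> ('a \<Rightarrow> real \<Rightarrow> real) \<Rightarrow> ('a \<Rightarrow> real) set set" where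
  "hammerstein_solutions p M T f = {X \<in> Lp_space p M. \<forall>x\<in>X. AE t in M.
     integrable M (\<lambda>s. T t s * f s (x s)) \<and> x t = (LINT s|M. T t s * f s (x s))}"

end

theory Submission
  imports Defs
begin

text \<open>
  By Hoelder's inequality the Hammerstein operator \<open>F\<close> maps the ball of radius \<open>\<gamma>\<close> into itself, and it
  is monotone for the almost-everywhere order because \<open>T > 0\<close>. No continuity of \<open>F\<close> is available, so
  fixed points come from order: by Fatou's lemma a chain in the ball has a supremum in the ball, hence
  so has a chain of points with \<open>x \<le> F x\<close>, and a maximal such point is fixed. Starting from \<open>0 < F 0\<close>
  yields a positive solution; starting from the supremum of a chain of solutions yields a solution
  above that chain. The integral of \<open>arctan x\<close> against a positive integrable weight is a bounded,
  strictly monotone functional, which reduces chains to increasing sequences.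
\<close>

subsection \<open>Hoelder's inequality and balls of \<open>L\<^sub>p\<close>\<close>

text \<open>Young's inequality dominates the product and makes it integrable; after division of both
  factors by their norms it gives the bound. Kernel sections will serve as \<open>g\<close>, and
  \<open>f s (x s)\<close> as \<open>h\<close>.\<close>

lemma Hoelder_inequality:
  fixes g h :: "'a \<Rightarrow> real"
  assumes pq: "p > 1" "q > 1" "1 / p + 1 / q = 1"
    and [measurable]: "g \<in> borel_measurable M" "h \<in> borel_measurable M"
    and g: "integrable M (\<lambda>s. \<bar>g s\<bar> powr q)" and h: "integrable M (\<lambda>s. \<bar>h s\<bar> powr p)"
  shows "integrable M (\<lambda>s. g s * h s)"
    and "\<bar>LINT s|M. g s * h s\<bar> \<le> (LINT s|M. \<bar>g s\<bar> powr q) powr (1 / q) * (LINT s|M. \<bar>h s\<bar> powr p) powr (1 / p)"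
proof -
  have bound: "norm (g s * h s) \<le> norm (\<bar>g s\<bar> powr q / q + \<bar>h s\<bar> powr p / p)" for s
    using Youngs_inequality[of q p "\<bar>g s\<bar>" "\<bar>h s\<bar>"] pq by (simp add: abs_mult add.commute)
  show int: "integrable M (\<lambda>s. g s * h s)"
  proof (rule Bochner_Integration.integrable_bound)
    show "integrable M (\<lambda>s. \<bar>g s\<bar> powr q / q + \<bar>h s\<bar> powr p / p)"
      using g h by simp
    show "(\<lambda>s. g s * h s) \<in> borel_measurable M" by measurable
  qed (use bound in auto)
  define G where "G = (LINT s|M. \<bar>g s\<bar> powr q)"
  define H where "H = (LINT s|M. \<bar>h s\<bar> powr p)"
  have nonneg: "G \<ge> 0" "H \<ge> 0" by (auto simp: G_def H_def)
  show "\<bar>LINT s|M. g s * h s\<bar> \<le> (LINT s|M. \<bar>g s\<bar> powr q) powr (1 / q) * (LINT s|M. \<bar>h s\<bar> powr p) powr (1 / p)"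
  \<comment> \<open>The normalisation divides by both norms, so a factor vanishing almost everywhere
    is treated apart.\<close>
  proof (cases "G = 0 \<or> H = 0")
    case True
    then have "(AE s in M. \<bar>g s\<bar> powr q = 0) \<or> (AE s in M. \<bar>h s\<bar> powr p = 0)"
      using integral_nonneg_eq_0_iff_AE[OF g] integral_nonneg_eq_0_iff_AE[OF h] by (auto simp: G_def H_def)
    then have "AE s in M. g s * h s = 0" by auto
    then have "(LINT s|M. g s * h s) = 0" by (rule integral_eq_zero_AE)
    then show ?thesis by simp
  next
    case False
    define A where "A = G powr (1 / q)"
    define B where "B = H powr (1 / p)"
    have AB: "A > 0" "B > 0" "A powr q = G" "B powr p = H"
      using False nonneg pq by (auto simp: A_def B_def powr_powr)
    have pt: "\<bar>g s * h s\<bar> / (A * B) \<le> \<bar>g s\<bar> powr q / (G * q) + \<bar>h s\<bar> powr p / (H * p)" for s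
      using Youngs_inequality[of q p "\<bar>g s\<bar> / A" "\<bar>h s\<bar> / B"] pq AB
      by (simp add: abs_mult add.commute powr_divide)
    \<comment> \<open>\<open>A\<close> and \<open>B\<close> are chosen so that the right-hand side
      integrates to \<open>1 / q + 1 / p\<close>.\<close>
    have "(LINT s|M. \<bar>g s * h s\<bar> / (A * B)) \<le> (LINT s|M. \<bar>g s\<bar> powr q / (G * q) + \<bar>h s\<bar> powr p / (H * p))"
    proof (rule integral_mono)
      show "integrable M (\<lambda>s. \<bar>g s * h s\<bar> / (A * B))" using int by simp
      show "integrable M (\<lambda>s. \<bar>g s\<bar> powr q / (G * q) + \<bar>h s\<bar> powr p / (H * p))"
        using g h by simp
    qed (rule pt)
    also have "\<dots> = G / (G * q) + H / (H * p)"
      using g h by (simp add: G_def H_def)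
    also have "\<dots> = 1" using False pq(3) by (simp add: add.commute)
    finally have "(LINT s|M. \<bar>g s * h s\<bar>) \<le> A * B"
      using AB by (simp add: field_simps)
    then show ?thesis
      unfolding A_def B_def G_def H_def by (rule order_trans[OF integral_abs_bound])
  qed
qed

section \<open>Balls of \<open>L_p\<close> and suprema of their increasing sequences\<close>

definition Lp_ball :: "real \<Rightarrow> 'a measure \<Rightarrow> real \<Rightarrow> ('a \<Rightarrow> real) set" where
  "Lp_ball p M r = {x \<in> Lp_fun p M. Lp_seminorm p M x \<le> r}"

lemma integrable_Lp_fun:
  assumes "x \<in> Lp_fun p M"
  shows "integrable M (\<lambda>s. \<bar>x s\<bar> powr p)"
  using assms by (auto simp: Lp_fun_def integrable_iff_bounded)

text \<open>Membership becomes a single bound on a nonnegative integral, finiteness included; this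
  is the form in which Fatou's lemma applies.\<close>

lemma Lp_ball_iff:
  assumes "p > 0" "r \<ge> 0"
  shows "x \<in> Lp_ball p M r \<longleftrightarrow>
    x \<in> borel_measurable M \<and> (\<integral>\<^sup>+ s. ennreal (\<bar>x s\<bar> powr p) \<partial>M) \<le> ennreal (r powr p)"
proof (cases "x \<in> Lp_fun p M")
  case True
  have I: "(LINT s|M. \<bar>x s\<bar> powr p) \<ge> 0" by simp
  have "(LINT s|M. \<bar>x s\<bar> powr p) powr (1 / p) \<le> r \<longleftrightarrow> (LINT s|M. \<bar>x s\<bar> powr p) \<le> r powr p"
  proof
    assume "(LINT s|M. \<bar>x s\<bar> powr p) powr (1 / p) \<le> r"
    then have "((LINT s|M. \<bar>x s\<bar> powr p) powr (1 / p)) powr p \<le> r powr p"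
      using assms by (intro powr_mono2) auto
    then show "(LINT s|M. \<bar>x s\<bar> powr p) \<le> r powr p" using assms by (simp add: powr_powr)
  next
    assume "(LINT s|M. \<bar>x s\<bar> powr p) \<le> r powr p"
    then have "(LINT s|M. \<bar>x s\<bar> powr p) powr (1 / p) \<le> (r powr p) powr (1 / p)"
      using assms by (intro powr_mono2) auto
    then show "(LINT s|M. \<bar>x s\<bar> powr p) powr (1 / p) \<le> r" using assms by (simp add: powr_powr)
  qed
  then show ?thesis
    using True nn_integral_eq_integral[OF integrable_Lp_fun[OF True]]
    by (simp add: Lp_ball_def Lp_seminorm_def Lp_fun_def)
next
  case False
  then show ?thesis
    using le_less_trans[OF _ ennreal_less_top] by (auto simp: Lp_ball_def Lp_fun_def)
qed

text \<open>A finite lower limit of the powers bounds infinitely many terms, and monotonicity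
  carries the bound back to all of them.\<close>

lemma incseq_convergent_of_liminf_powr:
  fixes X :: "nat \<Rightarrow> real"
  assumes "incseq X" "p \<ge> 1" and fin: "liminf (\<lambda>n. ennreal (\<bar>X n\<bar> powr p)) < \<infinity>"
  shows "convergent X"
proof -
  obtain C where C: "liminf (\<lambda>n. ennreal (\<bar>X n\<bar> powr p)) < ennreal C" "C \<ge> 0"
  proof -
    obtain c where c: "liminf (\<lambda>n. ennreal (\<bar>X n\<bar> powr p)) < c" "c < \<infinity>"
      using dense[OF fin] by auto
    then show ?thesis using that[of "enn2real c"] by (simp add: less_top)
  qed
  have "\<not> (\<forall>\<^sub>F n in sequentially. ennreal C \<le> ennreal (\<bar>X n\<bar> powr p))"
    using C(1) Liminf_bounded by (metis leD)
  then have freq: "\<exists>k\<ge>n. \<bar>X k\<bar> powr p < C" for n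
    by (auto simp: eventually_sequentially not_le ennreal_less_iff)
  \<comment> \<open>The \<open>1\<close> covers terms of modulus below 1, which their
    \<open>p\<close>-th power need not dominate.\<close>
  have "X n \<le> max 1 C" for n
  proof -
    obtain k where k: "k \<ge> n" "\<bar>X k\<bar> powr p < C" using freq by blast
    have "X k \<le> max 1 C"
    proof (cases "\<bar>X k\<bar> \<ge> 1")
      case True
      then have "\<bar>X k\<bar> \<le> \<bar>X k\<bar> powr p" using powr_mono[of 1 p "\<bar>X k\<bar>"] assms(2) by simp
      then show ?thesis using k by linarith
    qed auto
    then show ?thesis using incseqD[OF assms(1) k(1)] by linarith
  qed
  then show ?thesis
    using assms(1) by (metis incseq_convergent convergent_def)
qed

text \<open>The supremum is the pointwise limit. The terms may change sign, so their
  \<open>p\<close>-th absolute powers need not increase with \<open>n\<close>; Fatou's lemma, not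
  monotone convergence, makes the limit finite almost everywhere and keeps it in the ball.\<close>

lemma Lp_ball_incseq_lub:
  fixes c :: "nat \<Rightarrow> 'a \<Rightarrow> real"
  assumes p: "p \<ge> 1" and r: "r \<ge> 0" and c: "\<And>n. c n \<in> Lp_ball p M r"
    and inc: "\<And>n. AE t in M. c n t \<le> c (Suc n) t"
  obtains u where "u \<in> Lp_ball p M r" "\<And>n. AE t in M. c n t \<le> u t"
    "\<And>y. (\<And>n. AE t in M. c n t \<le> y t) \<Longrightarrow> AE t in M. u t \<le> y t"
proof -
  have [measurable]: "c n \<in> borel_measurable M" for n
    using c[of n] p r by (auto simp: Lp_ball_iff)
  \<comment> \<open>Where the sequence diverges, \<open>lim\<close> is an arbitrary value; this
    turns out to concern a null set only.\<close>
  define u where "u t = lim (\<lambda>n. c n t)" for t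
  have [measurable]: "u \<in> borel_measurable M"
    unfolding u_def by measurable
  have "(\<integral>\<^sup>+ t. liminf (\<lambda>n. ennreal (\<bar>c n t\<bar> powr p)) \<partial>M) \<le>
      liminf (\<lambda>n. \<integral>\<^sup>+ t. ennreal (\<bar>c n t\<bar> powr p) \<partial>M)"
    by (rule nn_integral_liminf) measurable
  also have "\<dots> \<le> ennreal (r powr p)"
    using c p r by (intro Liminf_le) (auto simp: Lp_ball_iff)
  finally have fatou: "(\<integral>\<^sup>+ t. liminf (\<lambda>n. ennreal (\<bar>c n t\<bar> powr p)) \<partial>M) \<le> ennreal (r powr p)" .
  have "AE t in M. liminf (\<lambda>n. ennreal (\<bar>c n t\<bar> powr p)) \<noteq> \<infinity>"
    using fatou by (intro nn_integral_PInf_AE) (auto simp: top_unique)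
  moreover have "AE t in M. incseq (\<lambda>n. c n t)"
    using inc by (simp add: incseq_Suc_iff AE_all_countable)
  ultimately have lim: "AE t in M. incseq (\<lambda>n. c n t) \<and> (\<lambda>n. c n t) \<longlonglongrightarrow> u t"
    by eventually_elim
      (use p incseq_convergent_of_liminf_powr in \<open>auto simp: u_def convergent_LIMSEQ_iff less_top\<close>)
  show ?thesis
  proof
    have "(\<integral>\<^sup>+ t. ennreal (\<bar>u t\<bar> powr p) \<partial>M) = (\<integral>\<^sup>+ t. liminf (\<lambda>n. ennreal (\<bar>c n t\<bar> powr p)) \<partial>M)"
      using lim
    proof (intro nn_integral_cong_AE, eventually_elim)
      case (elim t)
      have "(\<lambda>n. ennreal (\<bar>c n t\<bar> powr p)) \<longlonglongrightarrow> ennreal (\<bar>u t\<bar> powr p)"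
        using elim p by (intro tendsto_ennrealI tendsto_powr2 tendsto_rabs tendsto_const) auto
      then show ?case
        by (rule lim_imp_Liminf[OF trivial_limit_sequentially, symmetric])
    qed
    then show "u \<in> Lp_ball p M r" using fatou p r by (simp add: Lp_ball_iff)
    show "AE t in M. c n t \<le> u t" for n
      using lim by eventually_elim (auto intro: incseq_le)
    show "AE t in M. u t \<le> y t" if "\<And>n. AE t in M. c n t \<le> y t" for y
    proof -
      have "AE t in M. \<forall>n. c n t \<le> y t" using that by (simp add: AE_all_countable)
      with lim show ?thesis by eventually_elim (auto intro: LIMSEQ_le_const2)
    qed
  qed
qed

subsection \<open>Maximal elements\<close>

lemma le_of_less_add_inverse_Suc:
  fixes a b :: real
  assumes "\<And>n. a < b + 1 / Suc n"
  shows "a \<le> b"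
proof (rule field_le_epsilon)
  fix e :: real assume "e > 0"
  then obtain n where "1 / Suc n < e" by (rule nat_approx_posE)
  then show "a \<le> b + e" using assms[of n] by linarith
qed

text \<open>The Brezis--Browder ordering principle: a sequence that nearly exhausts \<open>\<Phi>\<close> above each of its
  terms is dominated only by elements above which \<open>\<Phi>\<close> is constant.\<close>

lemma Brezis_Browder:
  fixes \<Phi> :: "'b \<Rightarrow> real"
  assumes trans: "\<And>x y z. R x y \<Longrightarrow> R y z \<Longrightarrow> R x z" and refl: "\<And>x. R x x"
    and bdd: "bdd_above (\<Phi> ` A)"
    and mono: "\<And>x y. x \<in> A \<Longrightarrow> y \<in> A \<Longrightarrow> R x y \<Longrightarrow> \<Phi> x \<le> \<Phi> y"
    and ub: "\<And>c :: nat \<Rightarrow> 'b. (\<And>n. c n \<in> A) \<Longrightarrow> (\<And>n. R (c n) (c (Suc n))) \<Longrightarrow> \<exists>u\<in>A. \<forall>n. R (c n) u"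
    and a: "a \<in> A"
  obtains m where "m \<in> A" "R a m" "\<And>y. y \<in> A \<Longrightarrow> R m y \<Longrightarrow> \<Phi> y = \<Phi> m"
proof -
  \<comment> \<open>The best value of \<open>\<Phi>\<close> still attainable above
    \<open>x\<close>.\<close>
  define S where "S x = (SUP y\<in>{y \<in> A. R x y}. \<Phi> y)" for x
  have bdd': "bdd_above (\<Phi> ` {y \<in> A. R x y})" for x
    by (rule bdd_above_mono[OF bdd]) auto
  have "\<exists>y. (y \<in> A \<and> R a y) \<and> R x y \<and> S x - 1 / Suc n < \<Phi> y" if "x \<in> A \<and> R a x" for x n
  proof -
    have "\<exists>y\<in>{y \<in> A. R x y}. S x - 1 / Suc n < \<Phi> y"
      unfolding S_def using bdd' that refl by (subst less_cSUP_iff[symmetric]) auto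
    then show ?thesis using that trans by blast
  qed
  then have "\<exists>c. \<forall>n. (c n \<in> A \<and> R a (c n)) \<and> (R (c n) (c (Suc n)) \<and> S (c n) - 1 / Suc n < \<Phi> (c (Suc n)))"
    using a refl by (intro dependent_nat_choice) auto
  then obtain c where c: "\<And>n. c n \<in> A" "\<And>n. R a (c n)" "\<And>n. R (c n) (c (Suc n))"
      "\<And>n. S (c n) - 1 / Suc n < \<Phi> (c (Suc n))"
    by blast
  obtain u where u: "u \<in> A" "\<And>n. R (c n) u" using ub[of c] c by blast
  show ?thesis
  proof
    show "u \<in> A" by fact
    show "R a u" using c(2)[of 0] u(2)[of 0] by (rule trans)
    fix y assume y: "y \<in> A" "R u y"
    have "\<Phi> y < \<Phi> u + 1 / Suc n" for n
    proof -
      \<comment> \<open>Being above \<open>u\<close>, the point \<open>y\<close> is above every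
        \<open>c n\<close> and so competes in each \<open>S (c n)\<close>, which
        \<open>c (Suc n)\<close> attains up to \<open>1 / Suc n\<close>.\<close>
      have "\<Phi> y \<le> S (c n)"
        unfolding S_def using y u trans bdd' by (intro cSUP_upper) blast+
      also have "\<dots> < \<Phi> (c (Suc n)) + 1 / Suc n" using c(4)[of n] by linarith
      also have "\<dots> \<le> \<Phi> u + 1 / Suc n" using mono[OF c(1) u(1) u(2)] by simp
      finally show ?thesis .
    qed
    then have "\<Phi> y \<le> \<Phi> u"
      by (rule le_of_less_add_inverse_Suc)
    then show "\<Phi> y = \<Phi> u" using mono[OF u(1) y(1) y(2)] by simp
  qed
qed

text \<open>Sigma-finiteness supplies a positive integrable weight. As \<open>arctan\<close> is
  bounded, every measurable function has a finite weighted integral; as it is strictly increasing,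
  ordered functions with equal integrals agree almost everywhere.\<close>

lemma (in sigma_finite_measure) strictly_monotone_functional:
  "\<exists>\<Phi> :: ('a \<Rightarrow> real) \<Rightarrow> real. bounded (range \<Phi>) \<and>
     (\<forall>x\<in>borel_measurable M. \<forall>y\<in>borel_measurable M. (AE t in M. x t \<le> y t) \<longrightarrow>
        \<Phi> x \<le> \<Phi> y \<and> (\<Phi> x = \<Phi> y \<longrightarrow> (AE t in M. x t = y t)))"
proof -
  obtain w :: "'a \<Rightarrow> real" where w: "w \<in> borel_measurable M" "\<And>t. 0 < w t" "integrable M w"
    using obtain_positive_integrable_function by metis
  note [measurable] = w(1)
  define \<Phi> where "\<Phi> x = (LINT t|M. arctan (x t) * w t)" for x :: "'a \<Rightarrow> real"
  have arctan_bound: "\<bar>arctan z * w t\<bar> \<le> pi / 2 * w t" for z t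
    using arctan_bounded[of z] w(2)[of t] by (auto simp: abs_mult intro!: mult_right_mono)
  have int: "integrable M (\<lambda>t. arctan (x t) * w t)" if [measurable]: "x \<in> borel_measurable M" for x
  proof (rule Bochner_Integration.integrable_bound)
    show "integrable M (\<lambda>t. pi / 2 * w t)" using w(3) by simp
    show "(\<lambda>t. arctan (x t) * w t) \<in> borel_measurable M" by measurable
    show "AE t in M. norm (arctan (x t) * w t) \<le> norm (pi / 2 * w t)"
      unfolding real_norm_def by (intro AE_I2 order_trans[OF arctan_bound abs_ge_self])
  qed
  show ?thesis
  proof (intro exI[of _ \<Phi>] conjI ballI impI)
    have "\<bar>\<Phi> x\<bar> \<le> (LINT t|M. pi / 2 * w t)" for x
    proof (cases "integrable M (\<lambda>t. arctan (x t) * w t)")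
      case True
      have "\<bar>\<Phi> x\<bar> \<le> (LINT t|M. \<bar>arctan (x t) * w t\<bar>)" unfolding \<Phi>_def by (rule integral_abs_bound)
      also have "\<dots> \<le> (LINT t|M. pi / 2 * w t)"
        using True w(3) arctan_bound by (intro integral_mono) auto
      finally show ?thesis .
    next
      case False
      \<comment> \<open>The bound is claimed for all functions; the integral is 0 by convention when
        the integrand is not integrable.\<close>
      then show ?thesis using w(2) by (simp add: \<Phi>_def not_integrable_integral_eq less_imp_le)
    qed
    then show "bounded (range \<Phi>)" unfolding bounded_iff real_norm_def by blast
  next
    fix x y :: "'a \<Rightarrow> real"
    assume m: "x \<in> borel_measurable M" "y \<in> borel_measurable M" and le: "AE t in M. x t \<le> y t"
    have le': "AE t in M. arctan (x t) * w t \<le> arctan (y t) * w t"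
      using le by eventually_elim (use w(2) in \<open>auto simp: arctan_le_iff intro!: mult_right_mono less_imp_le\<close>)
    show "\<Phi> x \<le> \<Phi> y" unfolding \<Phi>_def using int m le' by (intro integral_mono_AE) auto
    assume "\<Phi> x = \<Phi> y"
    then have "(LINT t|M. arctan (y t) * w t - arctan (x t) * w t) = 0"
      using int m by (simp add: \<Phi>_def)
    then have "AE t in M. arctan (y t) * w t - arctan (x t) * w t = 0"
      using int m le' by (subst (asm) integral_nonneg_eq_0_iff_AE) auto
    then show "AE t in M. x t = y t"
      by eventually_elim (simp add: arctan_eq_iff less_imp_neq[OF w(2), symmetric])
  qed
qed

text \<open>An uncountable chain cannot be handled pointwise, since its exceptional null sets may
  have a union that is not null. An increasing sequence in the chain maximising
  \<open>\<Phi>\<close> already has the supremum of the whole chain.\<close>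

lemma (in sigma_finite_measure) Lp_ball_chain_lub:
  assumes p: "p \<ge> 1" and r: "r \<ge> 0" and C: "C \<subseteq> Lp_ball p M r" "C \<noteq> {}"
    and total: "\<And>x y. x \<in> C \<Longrightarrow> y \<in> C \<Longrightarrow> (AE t in M. x t \<le> y t) \<or> (AE t in M. y t \<le> x t)"
  obtains u where "u \<in> Lp_ball p M r" "\<And>x. x \<in> C \<Longrightarrow> AE t in M. x t \<le> u t"
    "\<And>y. (\<And>x. x \<in> C \<Longrightarrow> AE t in M. x t \<le> y t) \<Longrightarrow> AE t in M. u t \<le> y t"
proof -
  obtain \<Phi> :: "('a \<Rightarrow> real) \<Rightarrow> real" where bounded: "bounded (range \<Phi>)"
    and \<Phi>: "\<And>x y. x \<in> borel_measurable M \<Longrightarrow> y \<in> borel_measurable M \<Longrightarrow> AE t in M. x t \<le> y t \<Longrightarrow>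
       \<Phi> x \<le> \<Phi> y \<and> (\<Phi> x = \<Phi> y \<longrightarrow> (AE t in M. x t = y t))"
    using strictly_monotone_functional by blast
  have meas: "x \<in> borel_measurable M" if "x \<in> Lp_ball p M r" for x
    using that p r by (auto simp: Lp_ball_iff)
  have bdd: "bdd_above (\<Phi> ` C)" using bounded_imp_bdd_above[OF bounded] by (rule bdd_above_mono) auto
  define S where "S = (SUP x\<in>C. \<Phi> x)"
  have "\<exists>y. y \<in> C \<and> (AE t in M. x t \<le> y t) \<and> S - 1 / Suc n < \<Phi> y" if x: "x \<in> C" for x n
  proof -
    have "\<exists>y\<in>C. S - 1 / Suc n < \<Phi> y"
      unfolding S_def using bdd C by (subst less_cSUP_iff[symmetric]) auto
    then obtain y where y: "y \<in> C" "S - 1 / Suc n < \<Phi> y" by blast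
    show ?thesis
    proof (cases "AE t in M. x t \<le> y t")
      case True then show ?thesis using y by blast
    next
      case False
      \<comment> \<open>By totality \<open>y\<close> is below \<open>x\<close>, so \<open>x\<close>
        itself can be the next term.\<close>
      then have "\<Phi> y \<le> \<Phi> x" using total[OF x y(1)] x y C meas by (intro \<Phi>[THEN conjunct1]) auto
      then show ?thesis using x y by force
    qed
  qed
  then have "\<exists>c. \<forall>n. c n \<in> C \<and> ((AE t in M. c n t \<le> c (Suc n) t) \<and> S - 1 / Suc n < \<Phi> (c (Suc n)))"
    using C(2) by (intro dependent_nat_choice) auto
  then obtain c where c: "\<And>n. c n \<in> C" "\<And>n. AE t in M. c n t \<le> c (Suc n) t"
      "\<And>n. S - 1 / Suc n < \<Phi> (c (Suc n))"
    by blast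
  obtain u where u: "u \<in> Lp_ball p M r" "\<And>n. AE t in M. c n t \<le> u t"
    "\<And>y. (\<And>n. AE t in M. c n t \<le> y t) \<Longrightarrow> AE t in M. u t \<le> y t"
    using Lp_ball_incseq_lub[OF p r, of c M] c C by blast
  show ?thesis
  proof
    show "u \<in> Lp_ball p M r" by fact
    show "AE t in M. u t \<le> y t" if "\<And>x. x \<in> C \<Longrightarrow> AE t in M. x t \<le> y t" for y
      using u(3) that c(1) by blast
    fix x assume x: "x \<in> C"
    show "AE t in M. x t \<le> u t"
    proof (cases "\<exists>n. AE t in M. x t \<le> c n t")
      case True
      then obtain n where "AE t in M. x t \<le> c n t" by blast
      then show ?thesis using u(2)[of n] by eventually_elim linarith
    next
      case False
      \<comment> \<open>An \<open>x\<close> below no \<open>c n\<close> is above all of them, hence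
        above \<open>u\<close>; maximality of \<open>\<Phi>\<close> along the sequence then forces
        equality.\<close>
      then have ux: "AE t in M. u t \<le> x t" using total[OF x c(1)] by (intro u(3)) blast
      have "\<Phi> x < \<Phi> u + 1 / Suc n" for n
      proof -
        have "\<Phi> x \<le> S" unfolding S_def using x bdd by (intro cSUP_upper)
        also have "\<dots> < \<Phi> (c (Suc n)) + 1 / Suc n" using c(3)[of n] by linarith
        also have "\<Phi> (c (Suc n)) \<le> \<Phi> u" using u c(1)[of "Suc n"] C meas by (intro \<Phi>[THEN conjunct1]) auto
        finally show ?thesis by simp
      qed
      then have "\<Phi> x \<le> \<Phi> u"
        by (rule le_of_less_add_inverse_Suc)
      then have "\<Phi> u = \<Phi> x" using \<Phi>[THEN conjunct1, OF _ _ ux] x u C meas by force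
      then have "AE t in M. u t = x t" using ux x u C meas by (intro \<Phi>[THEN conjunct2, rule_format]) auto
      then show ?thesis by auto
    qed
  qed
qed

subsection \<open>The Hammerstein operator\<close>

locale hammerstein = sigma_finite_measure M for M :: "'a measure" +
  fixes T :: "'a \<Rightarrow> 'a \<Rightarrow> real" and f :: "'a \<Rightarrow> real \<Rightarrow> real" and p q r :: real
  assumes nontrivial: "emeasure M (space M) > 0"
    and T_measurable [measurable]: "(\<lambda>(t, s). T t s) \<in> borel_measurable (M \<Otimes>\<^sub>M M)"
    and exponents: "p > 1" "q > 1" "1 / p + 1 / q = 1"
    and kernel_finite: "kernel_const p q M T < \<infinity>"
    and T_pos: "AE (t, s) in M \<Otimes>\<^sub>M M. T t s > 0"
    and f_mono: "\<And>s a b. s \<in> space M \<Longrightarrow> a \<le> b \<Longrightarrow> f s a \<le> f s b"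
    and f_pos: "AE s in M. f s 0 > 0"
    and r_pos: "r > 0"
    and f_measurable: "\<And>x. x \<in> Lp_ball p M r \<Longrightarrow> (\<lambda>s. f s (x s)) \<in> borel_measurable M"
    and f_bound: "\<And>x. x \<in> Lp_ball p M r \<Longrightarrow>
      (\<integral>\<^sup>+ s. ennreal (\<bar>f s (x s)\<bar> powr p) \<partial>M) \<le> ennreal (r powr p) / kernel_const p q M T"
begin

definition operator :: "('a \<Rightarrow> real) \<Rightarrow> 'a \<Rightarrow> real" where
  "operator x t = (LINT s|M. T t s * f s (x s))"

lemma ball_iff: "x \<in> Lp_ball p M r \<longleftrightarrow>
    x \<in> borel_measurable M \<and> (\<integral>\<^sup>+ s. ennreal (\<bar>x s\<bar> powr p) \<partial>M) \<le> ennreal (r powr p)"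
  using exponents r_pos by (intro Lp_ball_iff) auto

section \<open>Sections of the kernel and the self-map property\<close>

lemma AE_kernel_pos: "AE t in M. AE s in M. T t s > 0"
proof -
  interpret pair_sigma_finite M M by unfold_locales
  show ?thesis using AE_pair[OF T_pos] by simp
qed

lemma kernel_section_measurable: "t \<in> space M \<Longrightarrow> T t \<in> borel_measurable M"
  using measurable_Pair2[OF T_measurable] by simp

lemma ennpowr_measurable [measurable]:
  "(\<lambda>t. ennpowr (\<integral>\<^sup>+ s. ennreal (\<bar>T t s\<bar> powr q) \<partial>M) (p / q)) \<in> borel_measurable M"
  unfolding ennpowr_def by measurable

text \<open>A finite outer integral has a finite integrand almost everywhere. It matters that
  \<open>ennpowr\<close> keeps infinity, so that infinite inner integrals are excluded.\<close>

lemma AE_integrable_kernel: "AE t in M. integrable M (\<lambda>s. \<bar>T t s\<bar> powr q)"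
proof -
  have "AE t in M. ennpowr (\<integral>\<^sup>+ s. ennreal (\<bar>T t s\<bar> powr q) \<partial>M) (p / q) \<noteq> \<infinity>"
    using kernel_finite by (intro nn_integral_PInf_AE) (auto simp: kernel_const_def)
  then show ?thesis
    using AE_space
  proof eventually_elim
    case (elim t)
    note [measurable] = kernel_section_measurable[OF elim(2)]
    have "(\<integral>\<^sup>+ s. ennreal (\<bar>T t s\<bar> powr q) \<partial>M) < \<infinity>"
      using elim(1) by (auto simp: ennpowr_def less_top split: if_splits)
    then show ?case by (intro integrableI_bounded) auto
  qed
qed

text \<open>If the constant were 0, almost every section of the positive kernel would vanish,
  against nontriviality of the measure. Positivity makes the bound on \<open>f\<close> finite, since
  division of a positive number by 0 gives infinity here.\<close>

lemma kernel_const_pos: "kernel_const p q M T > 0"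
proof (rule ccontr)
  assume "\<not> kernel_const p q M T > 0"
  then have "AE t in M. ennpowr (\<integral>\<^sup>+ s. ennreal (\<bar>T t s\<bar> powr q) \<partial>M) (p / q) = 0"
    by (simp add: kernel_const_def nn_integral_0_iff_AE zero_less_iff_neq_zero)
  then have "AE t in M. False"
    using AE_kernel_pos AE_integrable_kernel
  proof eventually_elim
    case (elim t)
    have "(\<integral>\<^sup>+ s. ennreal (\<bar>T t s\<bar> powr q) \<partial>M) = ennreal (LINT s|M. \<bar>T t s\<bar> powr q)"
      using elim(3) by (intro nn_integral_eq_integral) auto
    then have "(LINT s|M. \<bar>T t s\<bar> powr q) = 0"
      using elim(1) by (simp add: ennpowr_def)
    then have "AE s in M. \<bar>T t s\<bar> powr q = 0"
      using integral_nonneg_eq_0_iff_AE[OF elim(3)] by simp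
    then have "AE s in M. False"
      using elim(2) by eventually_elim simp
    then show ?case using nontrivial by (simp add: AE_iff_null null_sets_def)
  qed
  then show False using nontrivial by (simp add: AE_iff_null null_sets_def)
qed

lemma integrable_f_powr:
  assumes "x \<in> Lp_ball p M r"
  shows "integrable M (\<lambda>s. \<bar>f s (x s)\<bar> powr p)"
proof (rule integrableI_bounded)
  note [measurable] = f_measurable[OF assms]
  show "(\<lambda>s. \<bar>f s (x s)\<bar> powr p) \<in> borel_measurable M" by measurable
  have "ennreal (r powr p) / kernel_const p q M T < \<infinity>"
    using kernel_const_pos kernel_finite
    by (cases "kernel_const p q M T") (auto simp: divide_ennreal)
  then show "(\<integral>\<^sup>+ s. ennreal (norm (\<bar>f s (x s)\<bar> powr p)) \<partial>M) < \<infinity>"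
    using f_bound[OF assms] by (simp add: le_less_trans)
qed

lemma AE_integrable_operator:
  assumes x: "x \<in> Lp_ball p M r"
  shows "AE t in M. integrable M (\<lambda>s. T t s * f s (x s))"
  using AE_integrable_kernel AE_space
proof eventually_elim
  case (elim t)
  show ?case
    by (rule Hoelder_inequality(1)[OF exponents kernel_section_measurable[OF elim(2)]
          f_measurable[OF x] elim(1) integrable_f_powr[OF x]])
qed

text \<open>Hoelder in \<open>s\<close> for fixed \<open>t\<close>, raised to the power
  \<open>p\<close> and integrated over \<open>t\<close>, bounds the \<open>p\<close>-th power
  integral by the kernel constant times that of \<open>f s (x s)\<close>; the constant, positive and
  finite, then cancels.\<close>

lemma operator_in_ball:
  assumes x: "x \<in> Lp_ball p M r"
  shows "operator x \<in> Lp_ball p M r"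
proof -
  note [measurable] = f_measurable[OF x]
  define H where "H = (LINT s|M. \<bar>f s (x s)\<bar> powr p)"
  have H: "H \<ge> 0" "(\<integral>\<^sup>+ s. ennreal (\<bar>f s (x s)\<bar> powr p) \<partial>M) = ennreal H"
    using nn_integral_eq_integral[OF integrable_f_powr[OF x]] by (auto simp: H_def)
  have meas: "operator x \<in> borel_measurable M"
    unfolding operator_def[abs_def] by measurable
  have "AE t in M. ennreal (\<bar>operator x t\<bar> powr p) \<le>
      ennpowr (\<integral>\<^sup>+ s. ennreal (\<bar>T t s\<bar> powr q) \<partial>M) (p / q) * ennreal H"
    using AE_integrable_kernel AE_space
  proof eventually_elim
    case (elim t)
    define A where "A = (LINT s|M. \<bar>T t s\<bar> powr q)"
    have A: "A \<ge> 0" "(\<integral>\<^sup>+ s. ennreal (\<bar>T t s\<bar> powr q) \<partial>M) = ennreal A"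
      using nn_integral_eq_integral[OF elim(1)] by (auto simp: A_def)
    have "\<bar>operator x t\<bar> \<le> A powr (1 / q) * H powr (1 / p)"
      unfolding operator_def A_def H_def
      by (rule Hoelder_inequality(2)[OF exponents kernel_section_measurable[OF elim(2)]
          f_measurable[OF x] elim(1) integrable_f_powr[OF x]])
    then have "\<bar>operator x t\<bar> powr p \<le> (A powr (1 / q) * H powr (1 / p)) powr p"
      using exponents by (intro powr_mono2) auto
    also have "\<dots> = A powr (p / q) * H"
      using exponents H(1) by (simp add: powr_mult powr_powr)
    finally show ?case
      using A H(1) by (simp add: ennpowr_def ennreal_mult[symmetric] ennreal_leI)
  qed
  then have "(\<integral>\<^sup>+ t. ennreal (\<bar>operator x t\<bar> powr p) \<partial>M) \<le>
      (\<integral>\<^sup>+ t. ennpowr (\<integral>\<^sup>+ s. ennreal (\<bar>T t s\<bar> powr q) \<partial>M) (p / q) * ennreal H \<partial>M)"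
    by (rule nn_integral_mono_AE)
  also have "\<dots> = kernel_const p q M T * ennreal H"
    by (simp add: kernel_const_def nn_integral_multc)
  also have "\<dots> \<le> kernel_const p q M T * (ennreal (r powr p) / kernel_const p q M T)"
    using f_bound[OF x] H(2) by (intro mult_left_mono) auto
  also have "\<dots> = ennreal (r powr p)"
    using kernel_const_pos kernel_finite
    by (simp add: ennreal_times_divide mult_divide_eq_ennreal mult.commute)
  finally show ?thesis using meas by (simp add: ball_iff)
qed

section \<open>Monotonicity and fixed points of the operator\<close>

lemma operator_mono:
  assumes x: "x \<in> Lp_ball p M r" and y: "y \<in> Lp_ball p M r" and le: "AE t in M. x t \<le> y t"
  shows "AE t in M. operator x t \<le> operator y t"
  using AE_kernel_pos AE_integrable_operator[OF x] AE_integrable_operator[OF y]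
proof eventually_elim
  case (elim t)
  have "AE s in M. T t s * f s (x s) \<le> T t s * f s (y s)"
    using elim(1) le AE_space by eventually_elim (auto intro: f_mono mult_left_mono)
  then show ?case
    unfolding operator_def using elim by (intro integral_mono_AE) auto
qed

lemma zero_in_ball: "(\<lambda>_. 0) \<in> Lp_ball p M r"
  using exponents by (simp add: ball_iff)

lemma operator_zero_pos: "AE t in M. operator (\<lambda>_. 0) t > 0"
  using AE_kernel_pos AE_integrable_operator[OF zero_in_ball]
proof eventually_elim
  case (elim t)
  have pos: "AE s in M. T t s * f s 0 > 0"
    using elim(1) f_pos by eventually_elim simp
  then have nonneg: "AE s in M. T t s * f s 0 \<ge> 0" by eventually_elim simp
  have "(LINT s|M. T t s * f s 0) \<noteq> 0"
  proof
    assume "(LINT s|M. T t s * f s 0) = 0"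
    then have "AE s in M. T t s * f s 0 = 0"
      using integral_nonneg_eq_0_iff_AE[OF elim(2) nonneg] by simp
    then have "AE s in M. False" using pos by eventually_elim linarith
    then show False using nontrivial by (simp add: AE_iff_null null_sets_def)
  qed
  then show ?case
    using integral_nonneg_AE[OF nonneg] by (simp add: operator_def)
qed

text \<open>The ordering principle is applied to the points with \<open>x \<le> operator x\<close>.
  Above the resulting \<open>m\<close>, \<open>\<Phi>\<close> is constant on these points;
  \<open>operator m\<close> is one of them, so strict monotonicity of \<open>\<Phi>\<close> makes it
  equal to \<open>m\<close>.\<close>

lemma fixed_point_above:
  assumes a: "a \<in> Lp_ball p M r" "AE t in M. a t \<le> operator a t"
  obtains x where "x \<in> Lp_ball p M r" "AE t in M. a t \<le> x t" "AE t in M. x t = operator x t"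
proof -
  define A where "A = {x \<in> Lp_ball p M r. AE t in M. x t \<le> operator x t}"
  obtain \<Phi> :: "('a \<Rightarrow> real) \<Rightarrow> real" where bounded: "bounded (range \<Phi>)"
    and \<Phi>: "\<And>x y. x \<in> borel_measurable M \<Longrightarrow> y \<in> borel_measurable M \<Longrightarrow> AE t in M. x t \<le> y t \<Longrightarrow>
       \<Phi> x \<le> \<Phi> y \<and> (\<Phi> x = \<Phi> y \<longrightarrow> (AE t in M. x t = y t))"
    using strictly_monotone_functional by blast
  have meas: "x \<in> borel_measurable M" if "x \<in> Lp_ball p M r" for x
    using that by (simp add: ball_iff)
  obtain m where m: "m \<in> A" "AE t in M. a t \<le> m t"
    "\<And>y. y \<in> A \<Longrightarrow> AE t in M. m t \<le> y t \<Longrightarrow> \<Phi> y = \<Phi> m"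
  proof (rule Brezis_Browder[where R = "\<lambda>x y. AE t in M. x t \<le> y t" and A = A and \<Phi> = \<Phi> and a = a])
    show "AE t in M. x t \<le> z t" if "AE t in M. x t \<le> y t" "AE t in M. y t \<le> z t" for x y z :: "'a \<Rightarrow> real"
      using that by eventually_elim linarith
    show "AE t in M. x t \<le> x t" for x :: "'a \<Rightarrow> real" by simp
    show "bdd_above (\<Phi> ` A)"
      using bounded_imp_bdd_above[OF bounded] by (rule bdd_above_mono) auto
    show "\<Phi> x \<le> \<Phi> y" if "x \<in> A" "y \<in> A" "AE t in M. x t \<le> y t" for x y
      using that \<Phi> meas by (auto simp: A_def)
    show "a \<in> A" using a by (simp add: A_def)
    show "\<exists>u\<in>A. \<forall>n. AE t in M. c n t \<le> u t"
      if c: "\<And>n. c n \<in> A" and inc: "\<And>n. AE t in M. c n t \<le> c (Suc n) t" for c :: "nat \<Rightarrow> 'a \<Rightarrow> real"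
    proof -
      have cball: "c n \<in> Lp_ball p M r" for n using c by (simp add: A_def)
      obtain u where u: "u \<in> Lp_ball p M r" "\<And>n. AE t in M. c n t \<le> u t"
        "\<And>y. (\<And>n. AE t in M. c n t \<le> y t) \<Longrightarrow> AE t in M. u t \<le> y t"
        using Lp_ball_incseq_lub[of p r c M] exponents r_pos cball inc by (metis less_imp_le)
      \<comment> \<open>Each \<open>c n\<close> is below \<open>operator (c n)\<close>, hence below
        \<open>operator u\<close>; leastness of \<open>u\<close> replaces a passage to the limit
        under the integral.\<close>
      have "AE t in M. u t \<le> operator u t"
      proof (rule u(3))
        fix n
        have "AE t in M. c n t \<le> operator (c n) t" using c by (simp add: A_def)
        then show "AE t in M. c n t \<le> operator u t"
          using operator_mono[OF cball[of n] u(1) u(2)] by eventually_elim linarith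
      qed
      then show ?thesis using u by (auto simp: A_def)
    qed
  qed blast
  have mball: "m \<in> Lp_ball p M r" and le: "AE t in M. m t \<le> operator m t"
    using m(1) by (auto simp: A_def)
  have "operator m \<in> A"
    using operator_in_ball[OF mball] operator_mono[OF mball _ le] by (simp add: A_def)
  then have "\<Phi> (operator m) = \<Phi> m" using le by (rule m(3))
  then have "AE t in M. m t = operator m t"
    using \<Phi>[OF meas[OF mball] meas[OF operator_in_ball[OF mball]] le] by simp
  then show ?thesis using that mball m(2) by blast
qed

section \<open>Passage between representatives and classes\<close>

lemma Lp_class_solution:
  assumes x: "x \<in> Lp_ball p M r" and fixed: "AE t in M. x t = operator x t"
  shows "Lp_eq p M `` {x} \<in> hammerstein_solutions p M T f"
    and "Lp_norm p M (Lp_eq p M `` {x}) = Lp_seminorm p M x"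
    and "x \<in> Lp_eq p M `` {x}"
proof -
  have xfun: "x \<in> Lp_fun p M" using x by (simp add: Lp_ball_def)
  have X: "Lp_eq p M `` {x} \<in> Lp_space p M"
    unfolding Lp_space_def using xfun by (rule quotientI)
  show self: "x \<in> Lp_eq p M `` {x}"
    using equiv_class_self[OF equiv_Lp_eq xfun] .
  show norm: "Lp_norm p M (Lp_eq p M `` {x}) = Lp_seminorm p M x"
    using X self by (rule Lp_norm_eq)
  have "AE t in M. integrable M (\<lambda>s. T t s * f s (y s)) \<and> y t = (LINT s|M. T t s * f s (y s))"
    if y: "y \<in> Lp_eq p M `` {x}" for y
  proof -
    have xy: "AE t in M. x t = y t" using y by (simp add: Lp_eq_def)
    have yball: "y \<in> Lp_ball p M r"
      using Lp_norm_eq[OF X y] norm x y by (simp add: Lp_ball_def Lp_eq_def)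
    \<comment> \<open>Monotonicity in both directions shows that the operator respects equality
      almost everywhere, so the equation passes to every representative.\<close>
    have "AE t in M. operator x t \<le> operator y t" "AE t in M. operator y t \<le> operator x t"
      using xy by (intro operator_mono[OF x yball] operator_mono[OF yball x]; eventually_elim; simp)+
    with xy fixed AE_integrable_operator[OF yball] show ?thesis
      unfolding operator_def by eventually_elim simp
  qed
  then show "Lp_eq p M `` {x} \<in> hammerstein_solutions p M T f"
    using X by (simp add: hammerstein_solutions_def)
qed

lemma solution_representative:
  assumes "X \<in> hammerstein_solutions p M T f" "Lp_norm p M X \<le> r" "x \<in> X"
  shows "x \<in> Lp_ball p M r" "AE t in M. x t = operator x t"
proof -
  have X: "X \<in> Lp_space p M" using assms by (simp add: hammerstein_solutions_def)
  have "x \<in> Lp_fun p M"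
    using X assms(3) Union_quotient[OF equiv_Lp_eq, of p M] by (auto simp: Lp_space_def)
  then show "x \<in> Lp_ball p M r"
    using Lp_norm_eq[OF X assms(3)] assms(2) by (simp add: Lp_ball_def)
  show "AE t in M. x t = operator x t"
    using assms by (auto simp: hammerstein_solutions_def operator_def elim: AE_mp)
qed

lemma Lp_space_nonempty: "X \<in> Lp_space p M \<Longrightarrow> X \<noteq> {}"
  using in_quotient_imp_non_empty[OF equiv_Lp_eq] by (auto simp: Lp_space_def)

text \<open>One pair of representatives decides the order, as changing them alters values only on
  null sets.\<close>

lemma Lp_le_iff:
  assumes "X \<in> Lp_space p M" "Y \<in> Lp_space p M" "x \<in> X" "y \<in> Y"
  shows "(X, Y) \<in> Lp_le p M \<longleftrightarrow> (AE t in M. x t \<le> y t)"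
proof
  assume le: "AE t in M. x t \<le> y t"
  have "AE t in M. x' t \<le> y' t" if "x' \<in> X" "y' \<in> Y" for x' y'
  proof -
    have "AE t in M. x' t = x t" "AE t in M. y' t = y t"
      using quotient_eq_iff[OF equiv_Lp_eq, of X p M X x' x] quotient_eq_iff[OF equiv_Lp_eq, of Y p M Y y' y]
        assms that by (auto simp: Lp_space_def Lp_eq_def)
    with le show ?thesis by eventually_elim simp
  qed
  then show "(X, Y) \<in> Lp_le p M" using assms by (simp add: Lp_le_def)
qed (use assms in \<open>auto simp: Lp_le_def\<close>)

section \<open>Existence and upper bounds of solutions\<close>

lemma exists_positive_solution:
  "\<exists>X \<in> hammerstein_solutions p M T f. 0 < Lp_norm p M X \<and> Lp_norm p M X \<le> r"
proof -
  have "AE t in M. 0 \<le> operator (\<lambda>_. 0) t"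
    using operator_zero_pos by eventually_elim simp
  then obtain x where x: "x \<in> Lp_ball p M r" "AE t in M. 0 \<le> x t" "AE t in M. x t = operator x t"
    by (rule fixed_point_above[OF zero_in_ball])
  \<comment> \<open>From \<open>x \<ge> 0\<close> follows
    \<open>x = operator x \<ge> operator 0 > 0\<close>, which turns a nonnegative fixed point into a
    nonzero one.\<close>
  have pos: "AE t in M. x t > 0"
    using operator_zero_pos operator_mono[OF zero_in_ball x(1,2)] x(3) by eventually_elim linarith
  have int: "integrable M (\<lambda>s. \<bar>x s\<bar> powr p)"
    using x(1) by (intro integrable_Lp_fun) (simp add: Lp_ball_def)
  have "(LINT s|M. \<bar>x s\<bar> powr p) \<noteq> 0"
  proof
    assume "(LINT s|M. \<bar>x s\<bar> powr p) = 0"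
    then have "AE s in M. \<bar>x s\<bar> powr p = 0"
      using integral_nonneg_eq_0_iff_AE[OF int] by simp
    then have "AE s in M. False" using pos by eventually_elim simp
    then show False using nontrivial by (simp add: AE_iff_null null_sets_def)
  qed
  then have "Lp_seminorm p M x > 0" by (simp add: Lp_seminorm_def)
  then show ?thesis
    using Lp_class_solution[OF x(1,3)] x(1)
    by (intro bexI[of _ "Lp_eq p M `` {x}"]) (auto simp: Lp_ball_def)
qed

text \<open>The supremum \<open>u\<close> of a chain of solutions need not be a solution, but every
  member \<open>x\<close> satisfies \<open>x = operator x \<le> operator u\<close>, so
  \<open>u \<le> operator u\<close> and a fixed point above \<open>u\<close> bounds the
  chain.\<close>

lemma solutions_inductive:
  "inductive_subset (Lp_le p M) {X \<in> hammerstein_solutions p M T f. Lp_norm p M X \<le> r}"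
  unfolding inductive_subset_def
proof (intro ballI impI, elim conjE)
  fix C assume chain: "C \<in> Chains (Lp_le p M)" and nonempty: "C \<noteq> {}"
    and sub: "C \<subseteq> {X \<in> hammerstein_solutions p M T f. Lp_norm p M X \<le> r}"
  have space: "X \<in> Lp_space p M" if "X \<in> C" for X
    using sub that by (auto simp: hammerstein_solutions_def)
  have rep: "x \<in> Lp_ball p M r" "AE t in M. x t = operator x t" if "X \<in> C" "x \<in> X" for X x
    using solution_representative[of X x] sub that by auto
  have nonempty': "\<Union>C \<noteq> {}" using nonempty space Lp_space_nonempty by auto
  \<comment> \<open>All representatives of all classes are pooled, so none has to be chosen; two
    from the same class are comparable by reflexivity.\<close>
  have total: "(AE t in M. x t \<le> y t) \<or> (AE t in M. y t \<le> x t)" if xy: "x \<in> \<Union>C" "y \<in> \<Union>C" for x y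
  proof -
    obtain X Y where "X \<in> C" "Y \<in> C" "x \<in> X" "y \<in> Y" using xy by blast
    then show ?thesis using chain by (force simp: Chains_def Lp_le_def)
  qed
  have p: "p \<ge> 1" and r: "r \<ge> 0" and ball: "\<Union>C \<subseteq> Lp_ball p M r"
    using exponents r_pos rep by auto
  obtain u where u: "u \<in> Lp_ball p M r" "\<And>x. x \<in> \<Union>C \<Longrightarrow> AE t in M. x t \<le> u t"
    "\<And>y. (\<And>x. x \<in> \<Union>C \<Longrightarrow> AE t in M. x t \<le> y t) \<Longrightarrow> AE t in M. u t \<le> y t"
    by (rule Lp_ball_chain_lub[OF p r ball nonempty' total]) blast+
  have "AE t in M. u t \<le> operator u t"
  proof (rule u(3))
    fix x assume x: "x \<in> \<Union>C"
    then have "AE t in M. x t = operator x t" using rep by blast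
    moreover have "AE t in M. operator x t \<le> operator u t"
      using ball x u by (intro operator_mono) auto
    ultimately show "AE t in M. x t \<le> operator u t" by eventually_elim linarith
  qed
  then obtain v where v: "v \<in> Lp_ball p M r" "AE t in M. u t \<le> v t" "AE t in M. v t = operator v t"
    by (rule fixed_point_above[OF u(1)])
  note sol = Lp_class_solution[OF v(1,3)]
  have "(X, Lp_eq p M `` {v}) \<in> Lp_le p M" if X: "X \<in> C" for X
  proof -
    obtain x where x: "x \<in> X" using Lp_space_nonempty[OF space[OF X]] by blast
    have "AE t in M. x t \<le> u t" using u(2) X x by blast
    then have "AE t in M. x t \<le> v t" using v(2) by eventually_elim linarith
    then show ?thesis
      using sol(1,3) x space[OF X] by (subst Lp_le_iff) (auto simp: hammerstein_solutions_def)
  qed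
  then show "\<exists>U\<in>{X \<in> hammerstein_solutions p M T f. Lp_norm p M X \<le> r}. \<forall>X\<in>C. (X, U) \<in> Lp_le p M"
    using sol v(1) by (intro bexI[of _ "Lp_eq p M `` {v}"]) (auto simp: Lp_ball_def)
qed

end

text \<open>The bound on \<open>f\<close> is available only on the ball of radius \<gamma>, and the
  solution set is taken inside that ball.\<close>

theorem theorem4p1:
  fixes M :: "'a measure"
    and T :: "'a \<Rightarrow> 'a \<Rightarrow> real"
    and f :: "'a \<Rightarrow> real \<Rightarrow> real"
    and p q \<gamma> :: real
    and lam :: ennreal
  assumes sigma_finite: "sigma_finite_measure M"
    and nontrivial: "emeasure M (space M) > 0"
    and T_measurable: "(\<lambda>(t, s). T t s) \<in> borel_measurable (M \<Otimes>\<^sub>M M)"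
    and exponents: "p > 1" "q > 1" "1 / p + 1 / q = 1"
    and lam: "lam = kernel_const p q M T" "lam < \<infinity>"
    and T_pos: "AE (t, s) in M \<Otimes>\<^sub>M M. T t s > 0"
    and f_mono: "\<And>s a b. s \<in> space M \<Longrightarrow> a \<le> b \<Longrightarrow> f s a \<le> f s b"
    and f_pos: "AE s in M. f s 0 > 0"
    and gamma_pos: "\<gamma> > 0"
    and f_measurable: "\<And>x. x \<in> Lp_fun p M \<Longrightarrow> Lp_seminorm p M x \<le> \<gamma> \<Longrightarrow>
           (\<lambda>s. f s (x s)) \<in> borel_measurable M"
    and f_bound: "\<And>x. x \<in> Lp_fun p M \<Longrightarrow> Lp_seminorm p M x \<le> \<gamma> \<Longrightarrow>
           (\<integral>\<^sup>+ s. ennreal (\<bar>f s (x s)\<bar> powr p) \<partial>M) \<le> ennreal (\<gamma> powr p) / lam"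
  shows "(\<exists>X \<in> hammerstein_solutions p M T f. 0 < Lp_norm p M X \<and> Lp_norm p M X \<le> \<gamma>) \<and>
         {X \<in> hammerstein_solutions p M T f. Lp_norm p M X \<le> \<gamma>} \<noteq> {} \<and>
         inductive_subset (Lp_le p M) {X \<in> hammerstein_solutions p M T f. Lp_norm p M X \<le> \<gamma>}"
proof -
  interpret sigma_finite_measure M by (rule sigma_finite)
  interpret hammerstein M T f p q \<gamma>
    using assms by unfold_locales (auto simp: Lp_ball_def)
  show ?thesis
    using exists_positive_solution solutions_inductive by blast
qed

end
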